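(* For each integer $k\ge1$, $A_{2k}'=2A_{2k-1}'$ and $A_{2k+1}'=2A_{2k}'-A_k$.
   Context: All intervals are intervals of integers. For $k\ge1$, an ordered pair $(L,M)$ of subsets of $(0,k)$ is admissible if (1) $L\subseteq M$, and (2) for every $x\in M$ there exists $y\in L$ with $x+y\le k$ and $x+y\notin M$. $A_k$ is the number of admissible ordered pairs of subsets of $(0,k)$, and $A_k'$ is the number of subsets $L\subseteq(0,k)$ for which $(L,L)$ is admissible, i.e. such that for each $x\in L$ there is $y\in L$ with $x+y\le k$ and $x+y\notin L$. *)

theory Defs
  imports Main
begin

definition admissible :: "int \<Rightarrow> int set \<Rightarrow> int set \<Rightarrow> bool" where
  "admissible k L M \<longleftrightarrow>
     L \<subseteq> {0<..<k} \<and> M \<subseteq> {0<..<k} \<and> L \<subseteq> M \<and>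
     (\<forall>x\<in>M. \<exists>y\<in>L. x + y \<le> k \<and> x + y \<notin> M)"

definition A :: "int \<Rightarrow> nat" where
  "A k = card {(L, M). admissible k L M}"

definition A' :: "int \<Rightarrow> nat" where
  "A' k = card {L. admissible k L L}"

end

(* An element x of X is bad if x + y is in X for all y in X with x + y <= g. If x is bad and
   2x <= g, then 2x is a bad element of X. Hence (X, X) is admissible as soon as no element of X
   above g/2 is bad. Writing such elements as g - i with i < g/2, the condition at i involves only
   the elements y <= i of X and the i - y with g - (i - y) in X. So it depends only on the
   numbers up to i and their mirror images, and the middle point g/2 (for even g) is free. Passing
   from 2k - 1 to 2k + 1 adds the two free points k and k + 1 and the single condition at i = k;
   the pairs that violate this condition correspond to the admissible pairs for k. *)

theory Submission
  imports Defs
begin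

(* L is the lower half of X; U is the upper half, reflected by i |-> g - i. *)
definition good :: "int \<Rightarrow> int set \<Rightarrow> int set \<Rightarrow> bool" where
  "good n L U \<longleftrightarrow> L \<subseteq> {0<..<n} \<and> U \<subseteq> {0<..<n} \<and> (\<forall>u\<in>U. \<exists>y\<in>L. y \<le> u \<and> u - y \<notin> U)"

lemma finite_good: "finite {(L, U). good n L U}"
  by (rule finite_subset[of _ "Pow {0<..<n} \<times> Pow {0<..<n}"]) (auto simp: good_def)

text \<open>The induction is on the distance \<open>g - x\<close>: the elements \<open>x\<close>
  with \<open>g < 2 * x\<close> are the base case, and a bad element in the lower part would make
  its double, which is closer to \<open>g\<close>, bad as well.\<close>

lemma admissible_diag_iff_upper:
  "admissible g X X \<longleftrightarrow> X \<subseteq> {0<..<g} \<and>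
     (\<forall>x\<in>X. g < 2 * x \<longrightarrow> (\<exists>y\<in>X. x + y \<le> g \<and> x + y \<notin> X))"
proof
  assume R: "X \<subseteq> {0<..<g} \<and>
     (\<forall>x\<in>X. g < 2 * x \<longrightarrow> (\<exists>y\<in>X. x + y \<le> g \<and> x + y \<notin> X))"
  have "\<exists>y\<in>X. x + y \<le> g \<and> x + y \<notin> X" if "x \<in> X" for x
    using that
  proof (induction "nat (g - x)" arbitrary: x rule: less_induct)
    case less
    show ?case
    proof (rule ccontr)
      assume "\<not> ?thesis"
      then have bad: "\<And>y. y \<in> X \<Longrightarrow> x + y \<le> g \<Longrightarrow> x + y \<in> X"
        by blast
      have x: "0 < x" "x < g"
        using less.prems R by auto
      have "2 * x \<le> g"
        using bad less.prems R by (meson not_less)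
      then have "x + x \<in> X"
        using bad[of x] less.prems by simp
      moreover have "nat (g - (x + x)) < nat (g - x)"
        using x by simp
      ultimately obtain y where y: "y \<in> X" "x + x + y \<le> g" "x + x + y \<notin> X"
        using less.hyps by blast
      \<comment> \<open>Badness of \<open>x\<close> is used twice, first with \<open>y\<close> and
        then with \<open>x + y\<close>; together they put \<open>x + x + y\<close> into
        \<open>X\<close>, against the choice of \<open>y\<close>.\<close>
      then have "x + y \<in> X"
        using bad x by simp
      then show False
        using bad[of "x + y"] y by (simp add: add.assoc)
    qed
  qed
  then show "admissible g X X"
    using R by (simp add: admissible_def)
qed (auto simp: admissible_def)

text \<open>The bounds say that \<open>n\<close> is \<open>g / 2\<close> rounded up, so the
  \<open>x\<close> in (0, g) with \<open>g < 2 * x\<close> are exactly the \<open>g - i\<close> with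
  0 < i < n. The shift \<open>x + y\<close> is then \<open>g - (i - y)\<close>, again the mirror
  image of a number below \<open>n\<close>.\<close>

lemma admissible_diag_iff_good:
  assumes "2 * n - 1 \<le> g" "g \<le> 2 * n"
  shows "admissible g X X \<longleftrightarrow> X \<subseteq> {0<..<g} \<and>
    good n (X \<inter> {0<..<n}) {i \<in> {0<..<n}. g - i \<in> X}" (is "_ \<longleftrightarrow> _ \<and> good n ?L ?U")
proof (cases "X \<subseteq> {0<..<g}")
  case X: True
  have local: "(\<exists>y\<in>X. (g - i) + y \<le> g \<and> (g - i) + y \<notin> X) \<longleftrightarrow> (\<exists>y\<in>?L. y \<le> i \<and> i - y \<notin> ?U)"
    if "0 < i" "i < n" for i
  proof -
    \<comment> \<open>The boundary case \<open>y = i\<close> compares \<open>g\<close> with its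
      mirror image 0; neither lies in the set concerned.\<close>
    have mem: "(g - i) + y \<notin> X \<longleftrightarrow> i - y \<notin> ?U" if "y \<in> X" "y \<le> i" for y
    proof -
      have eq: "g - (i - y) = (g - i) + y" by simp
      have "y > 0" using X that by auto
      then show ?thesis
        unfolding mem_Collect_eq eq using X that \<open>i < n\<close> by (cases "y = i") auto
    qed
    have "y \<in> ?L" if "y \<in> X" "y \<le> i" for y
      using X that \<open>i < n\<close> by auto
    moreover have "(g - i) + y \<le> g \<longleftrightarrow> y \<le> i" for y
      by simp
    ultimately show ?thesis
      using mem by (meson IntD1)
  qed
  have "(\<forall>x\<in>X. g < 2 * x \<longrightarrow> (\<exists>y\<in>X. x + y \<le> g \<and> x + y \<notin> X)) \<longleftrightarrow>
        (\<forall>i\<in>?U. \<exists>y\<in>X. (g - i) + y \<le> g \<and> (g - i) + y \<notin> X)" (is "?l \<longleftrightarrow> ?r")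
  proof
    assume ?l
    then show ?r using assms by fastforce
  next
    assume r: ?r
    show ?l
    proof (intro ballI impI)
      fix x assume x: "x \<in> X" "g < 2 * x"
      then have "g - x \<in> ?U" using X assms by auto
      from bspec[OF r this] show "\<exists>y\<in>X. x + y \<le> g \<and> x + y \<notin> X" by simp
    qed
  qed
  also have "\<dots> \<longleftrightarrow> (\<forall>i\<in>?U. \<exists>y\<in>?L. y \<le> i \<and> i - y \<notin> ?U)"
    by (intro ball_cong refl local) auto
  finally show ?thesis
    using X unfolding admissible_diag_iff_upper good_def by blast
qed (simp add: admissible_def)

text \<open>The factor counts the subsets of the unconstrained middle \<open>{n..g - n}\<close>,
  which is empty for \<open>g = 2 * n - 1\<close> and is \<open>{n}\<close> for
  \<open>g = 2 * n\<close>.\<close>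

lemma A'_eq_card_good:
  assumes "n \<ge> 1" "2 * n - 1 \<le> g" "g \<le> 2 * n"
  shows "A' g = card {(L, U). good n L U} * 2 ^ nat (g - 2 * n + 1)"
proof -
  let ?split = "\<lambda>X. ((X \<inter> {0<..<n}, {i \<in> {0<..<n}. g - i \<in> X}), X \<inter> {n..g - n})"
  let ?join = "\<lambda>((L, U), C). L \<union> (\<lambda>i. g - i) ` U \<union> C"
  have join_split: "?join (?split X) = X" if "X \<subseteq> {0<..<g}" for X
  proof -
    have "x \<in> (\<lambda>i. g - i) ` {i \<in> {0<..<n}. g - i \<in> X}" if "x \<in> X" "g - n < x" for x
      using that \<open>X \<subseteq> _\<close> by (intro image_eqI[of _ _ "g - x"]) auto
    then show ?thesis
      using that by fastforce
  qed
  have split_join: "?split (?join ((L, U), C)) = ((L, U), C)"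
    if "L \<subseteq> {0<..<n}" "U \<subseteq> {0<..<n}" "C \<subseteq> {n..g - n}" for L U C
  proof -
    have "?join ((L, U), C) \<inter> {0<..<n} = L" "?join ((L, U), C) \<inter> {n..g - n} = C"
      using that assms by fastforce+
    moreover have "{i \<in> {0<..<n}. g - i \<in> ?join ((L, U), C)} = U"
      using that assms by fastforce
    ultimately show ?thesis by simp
  qed
  have "bij_betw ?split {X. admissible g X X} ({(L, U). good n L U} \<times> Pow {n..g - n})"
  proof (rule bij_betw_byWitness[where f' = ?join])
    show "\<forall>X\<in>{X. admissible g X X}. ?join (?split X) = X"
      using join_split by (simp add: admissible_def)
    show "\<forall>p\<in>{(L, U). good n L U} \<times> Pow {n..g - n}. ?split (?join p) = p"
    proof
      fix p assume "p \<in> {(L, U). good n L U} \<times> Pow {n..g - n}"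
      then obtain L U C where "p = ((L, U), C)" "good n L U" "C \<subseteq> {n..g - n}"
        by auto
      then show "?split (?join p) = p"
        using split_join[of L U C] unfolding good_def by blast
    qed
    show "?split ` {X. admissible g X X} \<subseteq> {(L, U). good n L U} \<times> Pow {n..g - n}"
      using admissible_diag_iff_good[OF assms(2,3)] by auto
    show "?join ` ({(L, U). good n L U} \<times> Pow {n..g - n}) \<subseteq> {X. admissible g X X}"
    proof clarify
      fix L U C assume G: "good n L U" and C: "C \<subseteq> {n..g - n}"
      define X where "X = ?join ((L, U), C)"
      have LU: "L \<subseteq> {0<..<n}" "U \<subseteq> {0<..<n}"
        using G by (auto simp: good_def)
      have "?split X = ((L, U), C)"
        unfolding X_def by (rule split_join[OF LU C])
      moreover have "X \<subseteq> {0<..<g}"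
      proof -
        have "L \<subseteq> {0<..<g}"
          by (rule order_trans[OF LU(1)]) (use assms in auto)
        moreover have "(\<lambda>i. g - i) ` U \<subseteq> {0<..<g}"
          by (rule order_trans[OF image_mono[OF LU(2)]]) (use assms in auto)
        moreover have "C \<subseteq> {0<..<g}"
          by (rule order_trans[OF C]) (use assms in auto)
        ultimately show ?thesis
          by (simp add: X_def)
      qed
      ultimately have "admissible g X X"
        using G admissible_diag_iff_good[OF assms(2,3), of X] by simp
      then show "admissible g (L \<union> (\<lambda>i. g - i) ` U \<union> C) (L \<union> (\<lambda>i. g - i) ` U \<union> C)"
        by (simp add: X_def)
    qed
  qed
  then have "A' g = card ({(L, U). good n L U} \<times> Pow {n..g - n})"
    unfolding A'_def by (rule bij_betw_same_card)
  also have "\<dots> = card {(L, U). good n L U} * 2 ^ nat (g - 2 * n + 1)"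
    by (simp add: card_cartesian_product card_Pow algebra_simps)
  finally show ?thesis .
qed

text \<open>Reflecting only \<open>M\<close>, with \<open>U = k - M\<close>, turns
  \<open>x + y\<close> into \<open>u - y\<close> for \<open>x = k - u\<close>, and
  \<open>L \<subseteq> M\<close> into the condition on \<open>k - y\<close>. That condition says
  that no \<open>y\<close> in \<open>L\<close> is a witness at \<open>u = k\<close>, which is how
  these pairs enter \<open>card_good_Suc\<close>.\<close>

lemma A_eq_card_good:
  "A k = card {(L, U). good k L U \<and> (\<forall>y\<in>L. k - y \<in> U)}"
proof -
  \<comment> \<open>This map is an involution, so it serves as its own inverse below.\<close>
  let ?r = "\<lambda>(L, M). (L, (\<lambda>x. k - x) ` M) :: int set \<times> int set"
  have mem: "x \<in> (\<lambda>x. k - x) ` M \<longleftrightarrow> k - x \<in> M" for x and M :: "int set"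
    by (auto intro: image_eqI[of _ _ "k - x"])
  have invol: "(\<lambda>x. k - x) ` (\<lambda>x. k - x) ` M = M" for M :: "int set"
    by (simp add: image_image)
  have range: "(\<lambda>x. k - x) ` M \<subseteq> {0<..<k} \<longleftrightarrow> M \<subseteq> {0<..<k}" for M
    by auto
  have iff: "admissible k L M \<longleftrightarrow>
      good k L ((\<lambda>x. k - x) ` M) \<and> (\<forall>y\<in>L. k - y \<in> (\<lambda>x. k - x) ` M)" for L M
  proof -
    have "k - (k - x - y) = x + y" "y \<le> k - x \<longleftrightarrow> x + y \<le> k" for x y
      by auto
    then show ?thesis
      unfolding admissible_def good_def range by (auto simp: mem)
  qed
  have "bij_betw ?r {(L, M). admissible k L M} {(L, U). good k L U \<and> (\<forall>y\<in>L. k - y \<in> U)}"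
    by (rule bij_betw_byWitness[where f' = ?r]) (auto simp: iff invol simp del: image_iff)
  then show ?thesis
    unfolding A_def by (rule bij_betw_same_card)
qed

text \<open>The sets \<open>a\<close> and \<open>b\<close> record whether \<open>k\<close> is added
  to \<open>L\<close> and to \<open>U\<close>. The conditions at \<open>u < k\<close> involve only
  numbers below \<open>k\<close>, so the sole new condition is the one at \<open>u = k\<close>,
  present when \<open>b = {k}\<close>.\<close>

lemma good_extend_iff:
  assumes "L \<subseteq> {0<..<k}" "U \<subseteq> {0<..<k}" "a \<subseteq> {k}" "b \<subseteq> {k}" "k \<ge> 1"
  shows "good (k + 1) (L \<union> a) (U \<union> b) \<longleftrightarrow>
    good k L U \<and> (b = {} \<or> a = {k} \<or> (\<exists>y\<in>L. k - y \<notin> U))"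
proof -
  have low: "(\<exists>y\<in>L \<union> a. y \<le> u \<and> u - y \<notin> U \<union> b) \<longleftrightarrow> (\<exists>y\<in>L. y \<le> u \<and> u - y \<notin> U)"
    if "u \<in> U" for u
  proof -
    have "u < k"
      using that assms(2) by auto
    then have "y \<notin> a" if "y \<le> u" for y
      using that assms(3) by (cases "y = k") auto
    moreover have "u - y \<notin> b" if "y \<in> L" for y
    proof -
      have "0 < y"
        using that assms(1) by auto
      then have "u - y \<noteq> k"
        using \<open>u < k\<close> by simp
      then show ?thesis
        using assms(4) by blast
    qed
    ultimately show ?thesis
      by blast
  qed
  have top: "(\<exists>y\<in>L \<union> a. y \<le> k \<and> k - y \<notin> U \<union> b) \<longleftrightarrow> a = {k} \<or> (\<exists>y\<in>L. k - y \<notin> U)"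
  proof (cases "a = {}")
    case True
    have "y \<le> k \<and> k - y \<notin> b" if "y \<in> L" for y
    proof -
      have "0 < y" "y < k"
        using that assms(1) by auto
      then have "y \<le> k" "k - y \<noteq> k"
        by auto
      then show ?thesis
        using assms(4) by blast
    qed
    with True show ?thesis
      by blast
  next
    case False
    then have "a = {k}"
      using assms(3) by blast
    \<comment> \<open>Hence \<open>y = k\<close> is itself a witness at \<open>u = k\<close>,
      because \<open>k - k = 0\<close>.\<close>
    moreover have "0 \<notin> U" "0 \<notin> b"
      using assms(2,4,5) by auto
    ultimately show ?thesis
      by (auto intro!: bexI[of _ k])
  qed
  have "{0<..<k} \<subseteq> {0<..<k + 1}" "{k} \<subseteq> {0<..<k + 1}"
    using assms(5) by auto
  then have "L \<union> a \<subseteq> {0<..<k + 1}" "U \<union> b \<subseteq> {0<..<k + 1}"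
    using assms(1-4) by blast+
  then have "good (k + 1) (L \<union> a) (U \<union> b) \<longleftrightarrow>
      (\<forall>u\<in>U. \<exists>y\<in>L \<union> a. y \<le> u \<and> u - y \<notin> U \<union> b) \<and>
      (\<forall>u\<in>b. \<exists>y\<in>L \<union> a. y \<le> u \<and> u - y \<notin> U \<union> b)"
    unfolding good_def by blast
  also have "\<dots> \<longleftrightarrow> good k L U \<and> (\<forall>u\<in>b. \<exists>y\<in>L \<union> a. y \<le> u \<and> u - y \<notin> U \<union> b)"
    using assms low unfolding good_def by simp
  also have "(\<forall>u\<in>b. \<exists>y\<in>L \<union> a. y \<le> u \<and> u - y \<notin> U \<union> b) \<longleftrightarrow>
      b = {} \<or> (a = {k} \<or> (\<exists>y\<in>L. k - y \<notin> U))"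
    using assms(4) top by (cases "b = {}") (auto simp: subset_singleton_iff)
  finally show ?thesis .
qed

text \<open>Each good pair for \<open>k\<close> has four extensions by \<open>a\<close> and
  \<open>b\<close>. The only one that can fail is \<open>a = {}\<close>, \<open>b = {k}\<close>, and
  it fails exactly for the pairs counted by \<open>A k\<close> (the set \<open>?H\<close>).\<close>

lemma card_good_Suc:
  assumes "k \<ge> 1"
  shows "card {(L, U). good (k + 1) L U} + A k = 4 * card {(L, U). good k L U}"
proof -
  let ?G = "{(L, U). good k L U} \<times> Pow {k} \<times> Pow {k}"
  let ?H = "{(L, U). good k L U \<and> (\<forall>y\<in>L. k - y \<in> U)} \<times> {({} :: int set, {k})}"
  let ?ext = "\<lambda>((L, U), (a, b)). (L \<union> a, U \<union> b) :: int set \<times> int set"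
  let ?res = "\<lambda>(L, U). ((L - {k}, U - {k}), (L \<inter> {k}, U \<inter> {k})) :: (int set \<times> int set) \<times> int set \<times> int set"
  have "bij_betw ?ext (?G - ?H) {(L, U). good (k + 1) L U}"
  proof (rule bij_betw_byWitness[where f' = ?res])
    \<comment> \<open>Goodness for \<open>k\<close> keeps \<open>k\<close> out of \<open>L\<close>
      and \<open>U\<close>, so \<open>a\<close> and \<open>b\<close> can be recovered.\<close>
    show "\<forall>p\<in>?G - ?H. ?res (?ext p) = p"
      by (fastforce simp: good_def)
    show "\<forall>p\<in>{(L, U). good (k + 1) L U}. ?ext (?res p) = p"
      by auto
    show "?ext ` (?G - ?H) \<subseteq> {(L, U). good (k + 1) L U}"
    proof
      fix q assume "q \<in> ?ext ` (?G - ?H)"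
      then obtain p where p: "p \<in> ?G - ?H" "q = ?ext p"
        by (rule imageE)
      obtain L U a b where "p = ((L, U), a, b)"
        by (metis surj_pair)
      with p have *: "good k L U" "a \<subseteq> {k}" "b \<subseteq> {k}" "((L, U), a, b) \<notin> ?H"
        and q: "q = (L \<union> a, U \<union> b)"
        by simp_all
      then have "L \<subseteq> {0<..<k}" "U \<subseteq> {0<..<k}"
        by (auto simp: good_def)
      moreover have "b = {} \<or> a = {k} \<or> (\<exists>y\<in>L. k - y \<notin> U)"
        using * by (auto simp: subset_singleton_iff)
      ultimately show "q \<in> {(L, U). good (k + 1) L U}"
        using * q assms by (simp add: good_extend_iff)
    qed
    show "?res ` {(L, U). good (k + 1) L U} \<subseteq> ?G - ?H"
    proof clarify
      fix L U assume G: "good (k + 1) L U"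
      then have "L - {k} \<subseteq> {0<..<k}" "U - {k} \<subseteq> {0<..<k}"
        by (fastforce simp: good_def)+
      then have "good k (L - {k}) (U - {k}) \<and>
          (U \<inter> {k} = {} \<or> L \<inter> {k} = {k} \<or> (\<exists>y\<in>L - {k}. k - y \<notin> U - {k}))"
        using good_extend_iff[of "L - {k}" k "U - {k}" "L \<inter> {k}" "U \<inter> {k}"] G assms
        by (simp add: Un_commute Int_Diff_Un Un_Diff_Int)
      then show "((L - {k}, U - {k}), L \<inter> {k}, U \<inter> {k}) \<in> ?G - ?H"
        by auto
    qed
  qed
  then have "card {(L, U). good (k + 1) L U} = card (?G - ?H)"
    by (rule bij_betw_same_card[symmetric])
  moreover have "card (?G - ?H) + card ?H = card ?G"
  proof -
    have H: "?H \<subseteq> ?G" and G: "finite ?G"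
      using finite_good by auto
    have "card (?G - ?H) = card ?G - card ?H"
      by (rule card_Diff_subset[OF finite_subset[OF H G] H])
    \<comment> \<open>This keeps the subtraction of natural numbers from being truncated.\<close>
    moreover have "card ?H \<le> card ?G"
      by (rule card_mono[OF G H])
    ultimately show ?thesis
      by (simp only: le_add_diff_inverse2)
  qed
  moreover have "card ?H = A k"
    by (simp add: A_eq_card_good card_cartesian_product)
  moreover have "card ?G = 4 * card {(L, U). good k L U}"
    by (simp add: card_cartesian_product card_Pow)
  ultimately show ?thesis
    by simp
qed

theorem theorem11:
  fixes k :: int
  assumes "k \<ge> 1"
  shows "A' (2 * k) = 2 * A' (2 * k - 1)
       \<and> int (A' (2 * k + 1)) = 2 * int (A' (2 * k)) - int (A k)"
proof -
  have odd: "A' (2 * k - 1) = card {(L, U). good k L U}"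
    using A'_eq_card_good[of k "2 * k - 1"] assms by simp
  have even: "A' (2 * k) = 2 * card {(L, U). good k L U}"
    using A'_eq_card_good[of k "2 * k"] assms by simp
  \<comment> \<open>Here \<open>2 * k + 1 = 2 * (k + 1) - 1\<close>, so \<open>n\<close> moves up to
    \<open>k + 1\<close> and the middle is empty again.\<close>
  have "A' (2 * k + 1) = card {(L, U). good (k + 1) L U}"
    using A'_eq_card_good[of "k + 1" "2 * k + 1"] assms by simp
  then show ?thesis
    using odd even card_good_Suc[OF assms] by simp
qed

end
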